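(* Let $G$ be a graph and $M$ a matching in $G$ such that $(G,M)$ satisfies property $\mathcal{P}$. Then every subgraph $H$ of $G_M$ with at least two vertices contains at least two vertices of degree at most $2$ in $H$.
   Context: All graphs are finite, simple and undirected. A graph is 2-connected if it has at least two vertices, is connected, and has no cut vertex. For a matching $M$ in $G$, $G[M]$ is the subgraph of $G$ induced by the endpoints of edges of $M$, and $G_M$ is the simple graph obtained from $G[M]$ by contracting each edge $xy\in M$ to a vertex $v_{xy}$ and removing parallel edges. $(G,M)$ satisfies property $\mathcal{P}$ if (i) $G_M$ is 2-connected, and (ii) for every edge $ab\in E(G)\setminus M$ with $a,b\in V(G[M])$, there is no cycle in $G-ab$ containing both $a$ and $b$. *)

theory Defs
  imports "Graph_Theory.Digraph_Component"
begin

text \<open>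
  A finite simple undirected graph is a \<^locale>\<open>pair_graph\<close>: every edge \<open>ab\<close> is stored as the two
  arcs \<open>(a, b)\<close> and \<open>(b, a)\<close>. Hence \<^const>\<open>out_degree\<close> is the degree of a vertex.
\<close>

text \<open>A cut vertex separates two other vertices lying in one connected component.\<close>

definition cut_vertex :: "('a, 'b) pre_digraph \<Rightarrow> 'a \<Rightarrow> bool" where
  "cut_vertex G v \<longleftrightarrow> v \<in> verts G \<and>
     (\<exists>u w. u \<noteq> v \<and> w \<noteq> v \<and> u \<rightarrow>\<^sup>*\<^bsub>G\<^esub> w \<and> \<not> u \<rightarrow>\<^sup>*\<^bsub>pre_digraph.del_vert G v\<^esub> w)"

definition two_connected :: "('a, 'b) pre_digraph \<Rightarrow> bool" where
  "two_connected G \<longleftrightarrow>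
     2 \<le> card (verts G) \<and> Digraph_Component.connected G \<and> \<not> (\<exists>v. cut_vertex G v)"

text \<open>
  In a symmetric digraph a single edge traversed back and forth is a directed cycle of length 2,
  so the cycles of the undirected graph are those of length at least 3. Each vertex of a cycle is
  the tail of one of its arcs.
\<close>

definition cycle_through :: "'a pair_pre_digraph \<Rightarrow> 'a \<Rightarrow> 'a \<Rightarrow> bool" where
  "cycle_through G a b \<longleftrightarrow>
     (\<exists>p. pre_digraph.cycle (with_proj G) p \<and> 3 \<le> length p \<and> a \<in> fst ` set p \<and> b \<in> fst ` set p)"

definition del_edge :: "'a pair_pre_digraph \<Rightarrow> 'a \<Rightarrow> 'a \<Rightarrow> 'a pair_pre_digraph" where
  "del_edge G a b = \<lparr> pverts = pverts G, parcs = parcs G - {(a, b), (b, a)} \<rparr>"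

definition matching :: "'a pair_pre_digraph \<Rightarrow> 'a set set \<Rightarrow> bool" where
  "matching G M \<longleftrightarrow>
     M \<subseteq> {{x, y} | x y. (x, y) \<in> parcs G} \<and> (\<forall>e\<in>M. \<forall>f\<in>M. e \<noteq> f \<longrightarrow> e \<inter> f = {})"

definition matching_subgraph ::
    "'a pair_pre_digraph \<Rightarrow> 'a set set \<Rightarrow> ('a, 'a \<times> 'a) pre_digraph" where
  "matching_subgraph G M = with_proj G \<restriction> \<Union>M"

text \<open>
  The vertex arising by contracting the matching edge \<open>xy\<close> is represented by the set \<open>{x, y}\<close> itself.
  Every vertex of the subgraph induced by \<open>M\<close> lies in exactly one such set, so an edge of that
  subgraph outside \<open>M\<close> becomes an edge between two distinct elements of \<open>M\<close>; parallel edges are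
  identified because the arcs form a set of pairs.
\<close>

definition contract_matching :: "'a pair_pre_digraph \<Rightarrow> 'a set set \<Rightarrow> 'a set pair_pre_digraph" where
  "contract_matching G M =
     \<lparr> pverts = M,
       parcs = {(e, f). e \<in> M \<and> f \<in> M \<and> e \<noteq> f \<and>
                  (\<exists>x\<in>e. \<exists>y\<in>f. x \<rightarrow>\<^bsub>matching_subgraph G M\<^esub> y)} \<rparr>"

definition property_P :: "'a pair_pre_digraph \<Rightarrow> 'a set set \<Rightarrow> bool" where
  "property_P G M \<longleftrightarrow>
     two_connected (with_proj (contract_matching G M)) \<and>
     (\<forall>a b. (a, b) \<in> parcs G \<and> {a, b} \<notin> M \<and>
            a \<in> verts (matching_subgraph G M) \<and> b \<in> verts (matching_subgraph G M) \<longrightarrow>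
            \<not> cycle_through (del_edge G a b) a b)"

lemma pair_graph_contract_matching:
  assumes "pair_graph G" "matching G M"
  shows "pair_graph (contract_matching G M)"
proof -
  interpret pair_graph G by fact
  have "M \<subseteq> (\<lambda>(x, y). {x, y}) ` parcs G"
    using assms(2) by (auto simp: matching_def)
  then have fin: "finite M"
    using pair_finite_arcs by (blast intro: finite_subset)
  have "parcs (contract_matching G M) \<subseteq> M \<times> M"
    by (auto simp: contract_matching_def)
  then have fin_arcs: "finite (parcs (contract_matching G M))"
    using fin by (blast intro: finite_subset)
  have sym: "y \<rightarrow>\<^bsub>matching_subgraph G M\<^esub> x" if "x \<rightarrow>\<^bsub>matching_subgraph G M\<^esub> y" for x y
    using that graph_symmetric[of x y]
    by (auto simp: matching_subgraph_def arcs_ends_conv image_iff)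
  show ?thesis
    using fin fin_arcs
    by unfold_locales
      (auto simp: contract_matching_def symmetric_def intro!: symI dest: sym)
qed

end

theory Submission
  imports Defs
begin

text \<open>
  Only separations matter: if \<open>a\<close> and \<open>b\<close> lie on no common cycle of
  \<open>G - ab\<close>, some vertex \<open>c\<close> separates them there (Menger). It suffices
  to find, for every root \<open>r\<close>, a vertex of degree at most 2 of the contracted graph
  other than \<open>r\<close>. In a minimal counterexample, cut along \<open>ab\<close> and
  \<open>c\<close>, keep the side \<open>A\<close> without \<open>r\<close>, and replace the
  other side by a path \<open>a, b, c\<close>. Minimality, applied to this graph with root
  \<open>b\<close> and once more to a slightly smaller one, forces \<open>A = {a}\<close>, apart
  from at most two edges at \<open>r\<close>. So each edge between distinct matching edges, up
  to these exceptions, has an end with no neighbour besides the other end and its partner. A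
  matching edge other than \<open>r\<close> contains at most one such end. If \<open>m\<close>
  matching edges other than \<open>r\<close> all have degree at least 3, then \<open>3 m \<le> 2
  m + 2\<close>, whereas \<open>m \<ge> 3\<close>.
\<close>

section \<open>Common cycles and separating vertices\<close>

definition avoiding :: "('a \<times> 'a) set \<Rightarrow> 'a \<Rightarrow> ('a \<times> 'a) set" where
  "avoiding R c = {(x, y) \<in> R. x \<noteq> c \<and> y \<noteq> c}"

abbreviation walk :: "('a \<times> 'a) set \<Rightarrow> 'a list \<Rightarrow> bool" where
  "walk R \<equiv> successively (\<lambda>x y. (x, y) \<in> R)"

text \<open>In a symmetric relation a single edge \<open>xy\<close> counts as the closed walk \<open>[x, y]\<close>; this covers
  the case of adjacent vertices in the induction below. Proper cycles have length at least 3.\<close>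

definition cyc :: "('a \<times> 'a) set \<Rightarrow> 'a list \<Rightarrow> bool" where
  "cyc R xs \<longleftrightarrow> distinct xs \<and> xs \<noteq> [] \<and> walk R xs \<and> (last xs, hd xs) \<in> R"

lemma walk_rev: "Relation.sym R \<Longrightarrow> walk R (rev xs) \<longleftrightarrow> walk R xs"
  unfolding successively_rev by (rule successively_cong) (auto dest: symD)

lemma walk_rtrancl: "walk R xs \<Longrightarrow> xs \<noteq> [] \<Longrightarrow> (hd xs, last xs) \<in> R\<^sup>*"
proof (induction xs)
  case (Cons x xs)
  then show ?case
    by (cases xs) (auto simp: successively_Cons intro: converse_rtrancl_into_rtrancl)
qed simp

lemma cyc_rotate: "cyc R (xs @ ys) \<Longrightarrow> cyc R (ys @ xs)"
  unfolding cyc_def by (cases "xs = []"; cases "ys = []") (auto simp: successively_append_iff)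

lemma cyc_rev:
  assumes "Relation.sym R" "cyc R (w # D)"
  shows "cyc R (w # rev D)"
proof -
  have "cyc R (rev (w # D))"
    using assms unfolding cyc_def walk_rev[OF assms(1)]
    by (auto simp: hd_rev last_rev simp del: rev.simps dest: symD)
  then show ?thesis using cyc_rotate[of R "rev D" "[w]"] by simp
qed

text \<open>Induction along the path. A step out of \<open>K\<close> starts a new tail, and a step
  onto a vertex already on the tail cuts the tail back to that vertex, which keeps it
  distinct.\<close>

lemma last_exit:
  assumes "(a, b) \<in> R\<^sup>*" "a \<in> K" "b \<notin> K"
  obtains z ys where "z \<in> K" "ys \<noteq> []" "last ys = b" "distinct ys" "set ys \<inter> K = {}"
    "walk R (z # ys)"
  using assms(1,3)
proof (induction arbitrary: thesis rule: rtrancl_induct)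
  case base
  then show ?case using assms(2) by blast
next
  case (step y b)
  show ?case
  proof (cases "y \<in> K")
    case True
    show ?thesis by (rule step.prems(1)[of y "[b]"]) (use True step in auto)
  next
    case False
    then obtain z ys where ys: "z \<in> K" "ys \<noteq> []" "last ys = y" "distinct ys" "set ys \<inter> K = {}"
      "walk R (z # ys)" using step.IH by blast
    show ?thesis
    proof (cases "b \<in> set ys")
      case True
      then obtain us vs where uv: "ys = us @ b # vs" by (meson split_list)
      show ?thesis
        by (rule step.prems(1)[of z "us @ [b]"]) (use ys uv in \<open>auto simp: successively_Cons successively_append_iff hd_append\<close>)
    next
      case False
      show ?thesis
        by (rule step.prems(1)[of z "ys @ [b]"])
          (use ys False step in \<open>auto simp: successively_Cons successively_append_iff hd_append\<close>)
    qed
  qed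
qed

text \<open>Follow the connection from \<open>a\<close> to \<open>b\<close> from its last vertex
  \<open>z\<close> on \<open>D\<close>. The arc of the cycle from \<open>w\<close> to
  \<open>z\<close> that contains \<open>a\<close>, this tail, and the edge \<open>bw\<close> form a
  cycle. Reversing \<open>D\<close> chooses the right arc.\<close>

lemma cyc_extend:
  assumes R: "Relation.sym R" and C: "cyc R (w # D)" "a \<in> set D" "b \<notin> set (w # D)"
    and wb: "(w, b) \<in> R" and ab: "(a, b) \<in> (avoiding R w)\<^sup>*"
  shows "\<exists>C. cyc R C \<and> 3 \<le> length C \<and> a \<in> set C \<and> b \<in> set C"
proof -
  obtain z ys where ys: "z \<in> set D" "ys \<noteq> []" "last ys = b" "distinct ys" "set ys \<inter> set D = {}"
    "walk (avoiding R w) (z # ys)"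
    using last_exit[OF ab C(2)] C(3) by (metis list.set_intros(2))
  have walk_ys: "walk R (z # ys)"
    using ys(6) by (rule successively_mono) (auto simp: avoiding_def)
  have "w \<notin> set ys"
  proof
    assume "w \<in> set ys"
    then obtain us vs where "ys = us @ w # vs" by (meson split_list)
    then show False using ys(6) by (cases us rule: rev_cases) (auto simp: avoiding_def successively_Cons successively_append_iff)
  qed
  have *: "\<exists>C. cyc R C \<and> 3 \<le> length C \<and> a \<in> set C \<and> b \<in> set C"
    if D: "cyc R (w # D1 @ z # D2)" "set (D1 @ z # D2) \<subseteq> set D" "a \<in> set (D1 @ [z])" for D1 D2
  proof (intro exI conjI)
    let ?C = "w # D1 @ z # ys"
    have "walk R (w # D1 @ [z])" "distinct (w # D1 @ [z])"
      using D(1) unfolding cyc_def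
      by (auto simp: successively_Cons successively_append_iff hd_append)
    moreover have "(b, w) \<in> R" using wb R by (auto dest: symD)
    ultimately show "cyc R ?C"
      unfolding cyc_def using walk_ys ys \<open>w \<notin> set ys\<close> D(2)
      by (cases D1) (auto simp: successively_Cons successively_append_iff hd_append)
    show "3 \<le> length ?C" using ys(2) by (cases ys) auto
    show "a \<in> set ?C" using D(3) by auto
    show "b \<in> set ?C" using last_in_set[OF ys(2)] ys(3) by simp
  qed
  obtain D1 D2 where D: "D = D1 @ z # D2" using ys(1) by (meson split_list)
  show ?thesis
  proof (cases "a \<in> set (D1 @ [z])")
    case True
    then show ?thesis using *[of D1 D2] C(1) D by simp
  next
    case False
    then show ?thesis using *[of "rev D2" "rev D1"] cyc_rev[OF R C(1)] C(2) D by auto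
  qed
qed

text \<open>Whitney's induction along the walk: the predecessor \<open>w\<close> of \<open>b\<close>
  also cannot be separated from \<open>a\<close>, so there is a cycle through \<open>a\<close> and
  \<open>w\<close>, and a connection avoiding \<open>w\<close> extends it to
  \<open>b\<close>.\<close>

lemma walk_cyc:
  assumes R: "Relation.sym R" and "walk R (a # xs @ [b])" "distinct (a # xs @ [b])"
    and "\<And>c. c \<noteq> a \<Longrightarrow> c \<noteq> b \<Longrightarrow> (a, b) \<in> (avoiding R c)\<^sup>*"
  shows "(a, b) \<in> R \<or> (\<exists>C. cyc R C \<and> 3 \<le> length C \<and> a \<in> set C \<and> b \<in> set C)"
  using assms(2-)
proof (induction xs arbitrary: b rule: rev_induct)
  case Nil
  then show ?case by simp
next
  case (snoc w xs)
  have w: "walk R (a # xs @ [w])" "distinct (a # xs @ [w])" "(w, b) \<in> R" "w \<noteq> a" "w \<noteq> b"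
    using snoc.prems(1,2) by (auto simp: successively_Cons successively_append_iff hd_append)
  have aw: "(a, w) \<in> (avoiding R c)\<^sup>*" if c: "c \<noteq> a" "c \<noteq> w" for c
  proof (cases "c = b")
    case False
    then have "(b, w) \<in> avoiding R c" using w R that by (auto simp: avoiding_def dest: symD)
    then show ?thesis using snoc.prems(3)[OF c(1) False] by (rule rtrancl_into_rtrancl[rotated])
  next
    case True
    have "walk (avoiding R c) (a # xs @ [w])"
      using w(1) by (rule successively_mono)
        (use True snoc.prems(2) in \<open>auto simp: avoiding_def\<close>)
    then show ?thesis using walk_rtrancl by fastforce
  qed
  have ab: "(a, b) \<in> (avoiding R w)\<^sup>*" using snoc.prems(3) w by blast
  obtain D where D: "cyc R (w # D)" "a \<in> set D"
  proof -
    consider "(a, w) \<in> R" | C where "cyc R C" "a \<in> set C" "w \<in> set C"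
      using snoc.IH[OF w(1,2) aw] by blast
    then show ?thesis
    proof cases
      case 1
      then have "cyc R (w # [a])" using R w unfolding cyc_def by (auto dest: symD)
      then show ?thesis using that by force
    next
      case 2
      then obtain us vs where "C = us @ w # vs" by (meson split_list)
      then have "cyc R (w # vs @ us)" "a \<in> set (vs @ us)"
        using cyc_rotate[of R us "w # vs"] 2 w by auto
      then show ?thesis using that by blast
    qed
  qed
  show ?case
  proof (cases "b \<in> set D")
    case True
    have "a \<noteq> b" using snoc.prems(2) by auto
    then have "card {a, b} \<le> card (set D)" using True D by (intro card_mono) auto
    then have "3 \<le> length (w # D)" using card_length[of D] \<open>a \<noteq> b\<close> by simp
    then show ?thesis using D True by (intro disjI2 exI[of _ "w # D"]) simp
  next
    case False
    then show ?thesis using cyc_extend[OF R D _ w(3) ab] w(5) by simp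
  qed
qed

lemma rtrancl_distinct_walk:
  assumes "(a, b) \<in> R\<^sup>*" "a \<noteq> b"
  obtains xs where "walk R (a # xs @ [b])" "distinct (a # xs @ [b])"
proof -
  obtain ys where ys: "ys \<noteq> []" "last ys = b" "distinct ys" "set ys \<inter> {a} = {}" "walk R (a # ys)"
    using last_exit[OF assms(1), of "{a}"] assms(2) by (metis singletonD singletonI)
  then have "ys = butlast ys @ [b]" by (metis append_butlast_last_id)
  then show ?thesis using ys that[of "butlast ys"] by (metis Int_insert_right disjoint_insert(1) distinct.simps(2))
qed

text \<open>The third vertex \<open>d\<close> covers the case where \<open>a\<close> and
  \<open>b\<close> are not connected at all: then it serves as \<open>c\<close> itself.\<close>

lemma cyc_or_cut:
  assumes "Relation.sym R" "(a, b) \<notin> R" "a \<noteq> b" "d \<noteq> a" "d \<noteq> b"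
    and no_cyc: "\<And>C. cyc R C \<Longrightarrow> 3 \<le> length C \<Longrightarrow> a \<in> set C \<Longrightarrow> b \<in> set C \<Longrightarrow> False"
  obtains c where "c \<noteq> a" "c \<noteq> b" "(a, b) \<notin> (avoiding R c)\<^sup>*"
proof (rule ccontr)
  assume "\<not> thesis"
  then have *: "\<And>c. c \<noteq> a \<Longrightarrow> c \<noteq> b \<Longrightarrow> (a, b) \<in> (avoiding R c)\<^sup>*" using that by blast
  have "(avoiding R d)\<^sup>* \<subseteq> R\<^sup>*" by (intro rtrancl_mono) (auto simp: avoiding_def)
  then have "(a, b) \<in> R\<^sup>*" using *[of d] assms(4,5) by blast
  then obtain xs where "walk R (a # xs @ [b])" "distinct (a # xs @ [b])"
    using assms(3) by (rule rtrancl_distinct_walk)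
  then show False using walk_cyc[OF assms(1) _ _ *] assms(2) no_cyc by blast
qed

section \<open>Separable edges and labels\<close>

text \<open>The set \<open>A\<close> is a union of components of the graph without \<open>ab\<close> and \<open>c\<close>. If \<open>ab\<close> is a bridge,
  \<open>c\<close> may be outside the graph.\<close>

definition separable :: "('a \<times> 'a) set \<Rightarrow> 'a \<Rightarrow> 'a \<Rightarrow> bool" where
  "separable E a b \<longleftrightarrow> (\<exists>A c. a \<in> A \<and> b \<notin> A \<and> c \<notin> A \<and> c \<noteq> b \<and>
     (\<forall>x y. (x, y) \<in> E \<longrightarrow> x \<in> A \<longrightarrow> y \<in> A \<or> y = c \<or> x = a \<and> y = b))"

lemma separableI:
  assumes "a \<in> A" "b \<notin> A" "c \<notin> A" "c \<noteq> b"
    and "\<And>x y. (x, y) \<in> E \<Longrightarrow> x \<in> A \<Longrightarrow> y \<in> A \<or> y = c \<or> x = a \<and> y = b"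
  shows "separable E a b"
  using assms unfolding separable_def by blast

definition nbr_labels :: "('a \<Rightarrow> 'b) \<Rightarrow> ('a \<times> 'a) set \<Rightarrow> 'b \<Rightarrow> 'b set" where
  "nbr_labels l E p = {l y | x y. (x, y) \<in> E \<and> l x = p \<and> l y \<noteq> p}"

lemma nbr_labelsI: "(x, y) \<in> E \<Longrightarrow> l x = p \<Longrightarrow> l y \<noteq> p \<Longrightarrow> l y \<in> nbr_labels l E p"
  unfolding nbr_labels_def by blast

lemma nbr_labelsE:
  assumes "q \<in> nbr_labels l E p"
  obtains x y where "(x, y) \<in> E" "l x = p" "l y = q" "q \<noteq> p"
  using assms unfolding nbr_labels_def by blast

text \<open>The labels \<open>l ` V\<close> stand for the vertices of the contracted graph: a matching edge is a pair of
  adjacent vertices with the same label, and unmatched vertices are allowed.\<close>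

locale contraction =
  fixes l :: "'a \<Rightarrow> 'b" and V :: "'a set" and E :: "('a \<times> 'a) set"
  assumes fin: "finite V"
    and wf: "(x, y) \<in> E \<Longrightarrow> x \<in> V \<and> y \<in> V"
    and sym: "(x, y) \<in> E \<Longrightarrow> (y, x) \<in> E"
    and mate: "x \<in> V \<Longrightarrow> y \<in> V \<Longrightarrow> x \<noteq> y \<Longrightarrow> l x = l y \<Longrightarrow> (x, y) \<in> E"
    and pair: "x \<in> V \<Longrightarrow> y \<in> V \<Longrightarrow> z \<in> V \<Longrightarrow> l x = l y \<Longrightarrow> l y = l z \<Longrightarrow>
                 x = y \<or> y = z \<or> x = z"
    and sep: "(a, b) \<in> E \<Longrightarrow> l a \<noteq> l b \<Longrightarrow> separable E a b"
begin

lemma finite_nbr_labels: "finite (nbr_labels l E p)"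
proof (rule finite_subset)
  show "nbr_labels l E p \<subseteq> l ` V"
    by (auto simp: wf elim!: nbr_labelsE)
  show "finite (l ` V)" using fin by simp
qed

lemma contraction_restrict:
  assumes "W \<subseteq> V"
  shows "contraction l W (E \<inter> W \<times> W)"
proof
  show "finite W" using assms fin finite_subset by blast
  show "x = y \<or> y = z \<or> x = z" if "x \<in> W" "y \<in> W" "z \<in> W" "l x = l y" "l y = l z" for x y z
    using that assms pair by blast
  show "separable (E \<inter> W \<times> W) a b" if "(a, b) \<in> E \<inter> W \<times> W" "l a \<noteq> l b" for a b
    using sep[of a b] that unfolding separable_def by blast
  show "(x, y) \<in> E \<inter> W \<times> W" if "x \<in> W" "y \<in> W" "x \<noteq> y" "l x = l y" for x y
    using that assms mate by blast
qed (use sym in auto)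

text \<open>The path \<open>a, b, s\<close> of the new graph stands for a path of \<open>E\<close> from \<open>a\<close> through \<open>b\<close> to \<open>s\<close>
  that leaves \<open>X\<close> in between, so the new graph is essentially a topological minor.\<close>

lemma contraction_augment:
  assumes X: "X \<subseteq> V" "a \<in> X" "s \<in> X" "a \<noteq> s" and b: "b \<in> V" "b \<notin> X" "l b \<notin> l ` X"
    and ab: "(a, b) \<in> E"
    and bs: "(b, s) \<in> (E \<inter> (insert s (V - X)) \<times> (insert s (V - X)))\<^sup>*"
  shows "contraction l (insert b X) (E \<inter> X \<times> X \<union> {(a, b), (b, a), (b, s), (s, b)})"
    (is "contraction l _ ?E")
proof
  show "finite (insert b X)" using X fin finite_subset by blast
  show "x = y \<or> y = z \<or> x = z"
    if "x \<in> insert b X" "y \<in> insert b X" "z \<in> insert b X" "l x = l y" "l y = l z" for x y z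
    using that X b pair[of x y z] by blast
  show "(x, y) \<in> ?E" if "x \<in> insert b X" "y \<in> insert b X" "x \<noteq> y" "l x = l y" for x y
  proof -
    have "x \<in> X \<and> y \<in> X" using that b by (metis image_eqI insert_iff)
    then show ?thesis using that X mate by blast
  qed
  show "x \<in> insert b X \<and> y \<in> insert b X" if "(x, y) \<in> ?E" for x y using that X by blast
  show "(y, x) \<in> ?E" if "(x, y) \<in> ?E" for x y using that sym by blast
  show "separable ?E u v" if uv: "(u, v) \<in> ?E" "l u \<noteq> l v" for u v
  proof -
    consider "(u, v) \<in> E" "u \<in> X" "v \<in> X" | "(u, v) = (a, b)" | "(u, v) = (b, a)"
      | "(u, v) = (b, s)" | "(u, v) = (s, b)"
      using uv by blast
    then show ?thesis
    proof cases
      case 1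
      obtain A c where A: "u \<in> A" "v \<notin> A" "c \<notin> A" "c \<noteq> v"
        and leave: "\<And>x y. (x, y) \<in> E \<Longrightarrow> x \<in> A \<Longrightarrow> y \<in> A \<or> y = c \<or> x = u \<and> y = v"
        using sep[OF 1(1) uv(2)] unfolding separable_def by blast
      show ?thesis
      proof (cases "c \<in> X")
        case True
        \<comment> \<open>The connection from \<open>b\<close> to \<open>s\<close> meets
          \<open>X\<close> only in \<open>s\<close>, so it avoids \<open>c\<close> and the edge
          \<open>uv\<close> and stays on one side of the separation.\<close>
        have same: "b \<in> A \<longleftrightarrow> y \<in> A"
          if "c \<noteq> s" "(b, y) \<in> (E \<inter> (insert s (V - X)) \<times> (insert s (V - X)))\<^sup>*" for y
          using that(2)
        proof (induction rule: rtrancl_induct)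
          case (step y z)
          then have yz: "(y, z) \<in> E" "(z, y) \<in> E" "y \<in> insert s (V - X)" "z \<in> insert s (V - X)"
            using sym by blast+
          have "y \<noteq> c" "z \<noteq> c" using yz that(1) True by blast+
          moreover have "\<not> (y = u \<and> z = v)" "\<not> (z = u \<and> y = v)"
            using yz 1 A by blast+
          ultimately have "y \<in> A \<longleftrightarrow> z \<in> A" using leave yz by blast
          then show ?case using step.IH by blast
        qed simp
        show ?thesis
        proof (rule separableI[OF A])
          show "y \<in> A \<or> y = c \<or> x = u \<and> y = v" if "(x, y) \<in> ?E" "x \<in> A" for x y
            using leave[of x y] leave[OF ab] leave[OF sym[OF ab]] same[OF _ bs] A(3) that by auto
        qed
      next
        case False
        \<comment> \<open>A separating vertex outside \<open>X\<close> is lost, but then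
          \<open>b\<close> is the only way out of \<open>X\<close> in the new graph and takes over
          its role.\<close>
        show ?thesis
        proof (rule separableI[of u "A \<inter> X" v b])
          show "y \<in> A \<inter> X \<or> y = b \<or> x = u \<and> y = v" if "(x, y) \<in> ?E" "x \<in> A \<inter> X" for x y
            using leave[of x y] False b(2) that by auto
        qed (use A 1 b in auto)
      qed
    next
      case 2
      show ?thesis by (rule separableI[of _ "X - {s}" _ s]) (use 2 X b in auto)
    next
      case 3
      show ?thesis by (rule separableI[of _ "{b}" _ s]) (use 3 X b in auto)
    next
      case 4
      show ?thesis by (rule separableI[of _ "{b}" _ a]) (use 4 X b in auto)
    next
      case 5
      show ?thesis by (rule separableI[of _ "X - {a}" _ a]) (use 5 X b in auto)
    qed
  qed
qed

end

text \<open>Minimality counts vertices, and \<open>smaller\<close> allows every root and every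
  relation on fewer vertices, because the reduced graphs get new edges and a new root.\<close>

locale rooted_counterexample = contraction +
  fixes r :: 'b
  assumes root: "r \<in> l ` V"
    and two_labels: "2 \<le> card (l ` V)"
    and high: "p \<in> l ` V \<Longrightarrow> p \<noteq> r \<Longrightarrow> 3 \<le> card (nbr_labels l E p)"
    and smaller: "card W < card V \<Longrightarrow> contraction l W F \<Longrightarrow> q \<in> l ` W \<Longrightarrow> 2 \<le> card (l ` W) \<Longrightarrow>
                    \<exists>p\<in>l ` W. p \<noteq> q \<and> card (nbr_labels l F p) \<le> 2"
begin

section \<open>Connectivity of a minimal counterexample\<close>

lemma not_low:
  assumes "x \<in> V" "l x \<noteq> r" "nbr_labels l E (l x) \<subseteq> B" "finite B" "card B \<le> 2"
  shows False
proof -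
  have "card (nbr_labels l E (l x)) \<le> card B" using assms by (simp add: card_mono)
  then show False using high[of "l x"] assms by force
qed

lemma not_low_pair:
  assumes "x \<in> V" "l x \<noteq> r" "nbr_labels l E (l x) \<subseteq> {p, q}"
  shows False
proof -
  have "card {p, q} \<le> 2" by (simp add: card_insert_if)
  then show False using not_low[OF assms] by simp
qed

lemma two_labelsI:
  assumes "finite W" "x \<in> W" "y \<in> W" "l x \<noteq> l y"
  shows "2 \<le> card (l ` W)"
proof -
  have "card {l x, l y} \<le> card (l ` W)" using assms by (intro card_mono) auto
  then show ?thesis using assms by simp
qed

text \<open>A single label \<open>q\<close> cannot cut off a proper root-free part: \<open>X\<close>
  together with all vertices labelled \<open>q\<close>, rooted at \<open>q\<close>, would be
  smaller, and its low label keeps all its neighbours and hence is low in \<open>E\<close>.\<close>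

lemma cut:
  assumes X: "X \<subseteq> V" "X \<noteq> {}" and q: "q \<in> l ` V"
    and avoid: "\<And>x. x \<in> X \<Longrightarrow> l x \<noteq> q" "\<And>x. x \<in> X \<Longrightarrow> l x \<noteq> r"
    and closed: "\<And>x y. (x, y) \<in> E \<Longrightarrow> x \<in> X \<Longrightarrow> y \<in> X \<or> l y = q"
    and v: "v \<in> V" "l v \<noteq> q"
  shows "v \<in> X"
proof (rule ccontr)
  assume "v \<notin> X"
  let ?W = "X \<union> {x \<in> V. l x = q}"
  let ?F = "E \<inter> ?W \<times> ?W"
  have W: "?W \<subseteq> V" using X by blast
  have "?W \<subset> V" using v \<open>v \<notin> X\<close> W by blast
  then have "card ?W < card V" using fin by (simp add: psubset_card_mono)
  moreover have "contraction l ?W ?F" by (rule contraction_restrict[OF W])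
  moreover have "q \<in> l ` ?W" using q by blast
  moreover have "2 \<le> card (l ` ?W)"
  proof -
    obtain x z where "x \<in> X" "z \<in> V" "l z = q" using X q by blast
    then show ?thesis using avoid(1) W fin finite_subset by (intro two_labelsI[of _ x z]) blast+
  qed
  ultimately obtain p where p: "p \<in> l ` ?W" "p \<noteq> q" "card (nbr_labels l ?F p) \<le> 2"
    using smaller by blast
  then obtain x where x: "x \<in> X" "p = l x" by blast
  have "nbr_labels l E (l x) \<subseteq> nbr_labels l ?F (l x)"
  proof
    fix q' assume "q' \<in> nbr_labels l E (l x)"
    then obtain y z where yz: "(y, z) \<in> E" "l y = l x" "l z = q'" "q' \<noteq> l x" by (elim nbr_labelsE)
    \<comment> \<open>The partner of \<open>x\<close> is adjacent to \<open>x\<close> and is not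
      labelled \<open>q\<close>, so \<open>X\<close> contains it too.\<close>
    have "y \<in> X"
    proof (cases "y = x")
      case False
      then have "(x, y) \<in> E" using mate[of x y] yz wf x X by auto
      then show ?thesis using closed x yz avoid by metis
    qed (use x in simp)
    then have "(y, z) \<in> ?F" using closed[OF yz(1)] yz wf X by blast
    then show "q' \<in> nbr_labels l ?F (l x)" using nbr_labelsI[of y z ?F l "l x"] yz by simp
  qed
  moreover have "finite (nbr_labels l ?F (l x))"
    using contraction.finite_nbr_labels[OF contraction_restrict[OF W]] .
  ultimately show False using not_low[of x] x p avoid X by blast
qed

text \<open>Here \<open>cut\<close> at the label of \<open>b\<close> puts every vertex with another
  label into \<open>X\<close>. As \<open>X\<close> misses the root, the root must be the label of
  \<open>b\<close>.\<close>

lemma bridge: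
  assumes X: "X \<subseteq> V" "a \<in> X" "b \<notin> X" and ab: "(a, b) \<in> E" "l a \<noteq> l b"
    and r: "\<And>x. x \<in> X \<Longrightarrow> l x \<noteq> r"
    and leave: "\<And>x y. (x, y) \<in> E \<Longrightarrow> x \<in> X \<Longrightarrow> y \<in> X \<or> x = a \<and> y = b"
  shows "l b = r" "\<And>y. (b, y) \<in> E \<Longrightarrow> y = a \<or> l y = r"
proof -
  have "l x \<noteq> l b" if "x \<in> X" for x
  proof
    assume "l x = l b"
    then have "(x, b) \<in> E" using mate[of x b] that X ab wf by blast
    then show False using leave that X ab \<open>l x = l b\<close> by blast
  qed
  then have in_X: "v \<in> X" if "v \<in> V" "l v \<noteq> l b" for v
    using cut[of X "l b" v] that X ab wf leave r by blast
  then show lb: "l b = r" using root r by (metis imageE)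
  show "y = a \<or> l y = r" if "(b, y) \<in> E" for y
  proof (cases "l y = r")
    case False
    then have "y \<in> X" using in_X that lb wf by metis
    then show ?thesis using leave[OF sym[OF that]] X by blast
  qed simp
qed

section \<open>Thin edges and exceptional root vertices\<close>

definition thin :: "'a \<Rightarrow> 'a \<Rightarrow> bool" where
  "thin a b \<longleftrightarrow> (a, b) \<in> E \<and> l a \<noteq> l b \<and> l a \<noteq> r \<and> (\<forall>y. (a, y) \<in> E \<longrightarrow> y = b \<or> l y = l a)"

definition outer :: "'a \<Rightarrow> 'a set" where
  "outer b = {y. (b, y) \<in> E \<and> l y \<noteq> r}"

text \<open>The two alternatives share a budget of two edges for the whole root: one for each of at
  most two vertices, or two for a single one.\<close>

definition exceptional :: "'a \<Rightarrow> bool" where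
  "exceptional b \<longleftrightarrow> b \<in> V \<and> l b = r \<and>
     (card (outer b) \<le> 1 \<or> card (outer b) \<le> 2 \<and> {x \<in> V. l x = r} = {b})"

lemma exceptionalI:
  assumes "(b, a) \<in> E" "l b = r" "\<And>y. (b, y) \<in> E \<Longrightarrow> y = a \<or> l y = r"
  shows "exceptional b"
proof -
  have "outer b \<subseteq> {a}" using assms(3) unfolding outer_def by blast
  then have "card (outer b) \<le> card {a}" by (intro card_mono) auto
  then show ?thesis unfolding exceptional_def using assms wf by auto
qed

text \<open>Orienting the separation so that \<open>A\<close> misses the root is what lets minimality be used on \<open>A\<close>.\<close>

lemma exceptional_or_thin:
  assumes ab: "(a, b) \<in> E" "l a \<noteq> l b"
    and A: "A \<subseteq> V" "a \<in> A" "b \<notin> A" "c \<notin> A" "c \<noteq> b"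
    and leave: "\<And>x y. (x, y) \<in> E \<Longrightarrow> x \<in> A \<Longrightarrow> y \<in> A \<or> y = c \<or> x = a \<and> y = b"
    and r: "\<And>x. x \<in> A \<Longrightarrow> l x \<noteq> r"
  shows "thin a b \<or> exceptional b"
proof (rule ccontr)
  assume contra: "\<not> (thin a b \<or> exceptional b)"
  have V: "a \<in> V" "b \<in> V" using ab wf by auto
  have no_bridge: False
    if X: "X \<subseteq> V" "a \<in> X" "b \<notin> X" and r: "\<And>x. x \<in> X \<Longrightarrow> l x \<noteq> r"
      and leave: "\<And>x y. (x, y) \<in> E \<Longrightarrow> x \<in> X \<Longrightarrow> y \<in> X \<or> x = a \<and> y = b" for X
    using bridge[OF X ab r leave] exceptionalI[OF sym[OF ab(1)]] contra by blast
  have lb: "l x \<noteq> l b" if "x \<in> A" for x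
  proof
    assume "l x = l b"
    then have "(x, b) \<in> E" using mate[of x b] that A ab wf by blast
    then show False using leave that A ab \<open>l x = l b\<close> by blast
  qed
  have lbA: "l b \<notin> l ` A" using lb by (metis imageE)
  have cV: "c \<in> V"
  proof (rule ccontr)
    assume "c \<notin> V"
    show False
    proof (rule no_bridge[OF A(1,2,3)])
      show "y \<in> A \<or> x = a \<and> y = b" if "(x, y) \<in> E" "x \<in> A" for x y
        using leave[OF that] wf[OF that(1)] \<open>c \<notin> V\<close> by blast
    qed (rule r)
  qed
  \<comment> \<open>If \<open>c\<close> is the partner of \<open>a\<close>, their label cuts off the
    rest of \<open>A\<close>. By \<open>cut\<close> this rest is empty, so \<open>a\<close> is
    thin.\<close>
  have la: "l c \<noteq> l a"
  proof
    assume eq: "l c = l a"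
    have "A - {a} = {}"
    proof (rule ccontr)
      assume ne: "A - {a} \<noteq> {}"
      have "b \<in> A - {a}"
      proof (rule cut[OF _ ne])
        show "l x \<noteq> l a" if "x \<in> A - {a}" for x
        proof
          assume "l x = l a"
          then have "x = a \<or> a = c \<or> x = c"
            using that A(1) V cV eq by (intro pair) auto
          then show False using that A by blast
        qed
        show "y \<in> A - {a} \<or> l y = l a" if "(x, y) \<in> E" "x \<in> A - {a}" for x y
          using leave[OF that(1)] that(2) eq by auto
        show "l b \<noteq> l a" using ab by simp
      qed (use A V r in auto)
      then show False using A by blast
    qed
    then have "A = {a}" using A by blast
    then have "thin a b" unfolding thin_def using ab r A leave[of a] eq by auto
    then show False using contra by blast
  qed
  have lcb: "l c \<noteq> l b"
  proof
    assume eq: "l c = l b"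
    have in_A: "v \<in> A" if "v \<in> V" "l v \<noteq> l b" for v
    proof (rule cut[of A "l b"])
      show "y \<in> A \<or> l y = l b" if "(x, y) \<in> E" "x \<in> A" for x y
        using leave[OF that] eq by auto
    qed (use that A V r lb in auto)
    then have "l b = r" using root r by (metis imageE)
    moreover have "y = a \<or> l y = r" if "(b, y) \<in> E" for y
    proof (cases "l y = r")
      case False
      then have "y \<in> A" using in_A[of y] that wf \<open>l b = r\<close> by auto
      then show ?thesis using leave[OF sym[OF that]] A by auto
    qed simp
    ultimately show False using exceptionalI[OF sym[OF ab(1)]] contra by blast
  qed
  \<comment> \<open>Otherwise \<open>ab\<close> is the only edge between the part \<open>?B\<close>
    reached from \<open>b\<close> and its complement. The root lies wholly on one side, and
    \<open>bridge\<close> applies to the other.\<close>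
  have bc: "(b, c) \<in> (E \<inter> (V - A) \<times> (V - A))\<^sup>*" (is "_ \<in> ?R\<^sup>*")
  proof (rule ccontr)
    assume nc: "(b, c) \<notin> ?R\<^sup>*"
    let ?B = "?R\<^sup>* `` {b}"
    have B: "?B \<subseteq> V - A" "c \<notin> ?B"
      using nc V A by (auto elim: rtranclE)
    have leaveB: "y \<in> ?B \<or> x = b \<and> y = a" if "(x, y) \<in> E" "x \<in> ?B" for x y
    proof (cases "y \<in> A")
      case True
      then show ?thesis using leave[OF sym[OF that(1)]] B that by blast
    next
      case False
      then have "(x, y) \<in> ?R" using that B wf by blast
      then show ?thesis using that by (auto intro: rtrancl_into_rtrancl)
    qed
    have rB: "l x \<noteq> r" if "x \<in> ?B" "z \<in> V - ?B" "l z = r" for x z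
    proof
      assume "l x = r"
      moreover have "x \<in> V" "z \<in> V" "x \<noteq> z" using that B by blast+
      ultimately have "(x, z) \<in> E" using mate[of x z] that(3) by simp
      then show False using leaveB[of x z] that \<open>l x = r\<close> ab by auto
    qed
    have "\<exists>z\<in>V - ?B. l z = r"
    proof (rule ccontr)
      assume no: "\<not> (\<exists>z\<in>V - ?B. l z = r)"
      show False
      proof (rule no_bridge[of "V - ?B"])
        show "y \<in> V - ?B \<or> x = a \<and> y = b" if "(x, y) \<in> E" "x \<in> V - ?B" for x y
          using leaveB[OF sym[OF that(1)]] that wf by blast
      qed (use no B V A in auto)
    qed
    then have "l a = r"
    proof (elim bexE)
      fix z assume z: "z \<in> V - ?B" "l z = r"
      show "l a = r"
      proof (rule bridge(1))
        show "l x \<noteq> r" if "x \<in> ?B" for x using rB[OF that z] .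
        show "y \<in> ?B \<or> x = b \<and> y = a" if "(x, y) \<in> E" "x \<in> ?B" for x y
          using leaveB[OF that] .
      qed (use B A ab sym in auto)
    qed
    then show False using r A by blast
  qed
  \<comment> \<open>The other side is replaced by the path \<open>a, b, c\<close>: only the label of \<open>c\<close> can become low.\<close>
  define X1 where "X1 = insert c A"
  define E1 where "E1 = E \<inter> X1 \<times> X1 \<union> {(a, b), (b, a), (b, c), (c, b)}"
  have X1: "X1 \<subseteq> V" "a \<in> X1" "c \<in> X1" "a \<noteq> c" "b \<notin> X1" "l b \<notin> l ` X1"
    using A cV lcb la lbA unfolding X1_def by auto
  have "insert c (V - X1) = V - A" using cV A unfolding X1_def by blast
  then have con1: "contraction l (insert b X1) E1"
    unfolding E1_def using X1 V ab bc by (intro contraction_augment) auto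
  \<comment> \<open>In case of equality \<open>b\<close> is alone in its label and has no neighbours
    but \<open>a\<close> and \<open>c\<close>: its label is low, or it is the root and
    \<open>b\<close> is exceptional by the second alternative.\<close>
  have "insert b X1 \<noteq> V"
  proof
    assume eq: "insert b X1 = V"
    have fib: "x = b" if "x \<in> V" "l x = l b" for x
    proof (rule ccontr)
      assume "x \<noteq> b"
      then have "x \<in> X1" using that(1) eq by blast
      then show False using X1(6) imageI[of x X1 l] that(2) by simp
    qed
    have nb: "y = a \<or> y = b \<or> y = c" if "(b, y) \<in> E" for y
      using leave[OF sym[OF that]] that eq wf A unfolding X1_def by blast
    show False
    proof (cases "l b = r")
      case False
      have "nbr_labels l E (l b) \<subseteq> {l a, l c}"
        using fib nb wf by (fastforce elim!: nbr_labelsE)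
      then show False using not_low_pair[OF V(2) False] by blast
    next
      case True
      have "outer b \<subseteq> {a, c}" unfolding outer_def using nb True by blast
      then have "card (outer b) \<le> card {a, c}" by (intro card_mono) auto
      also have "\<dots> \<le> 2" by (simp add: card_insert_if)
      finally have "card (outer b) \<le> 2" .
      moreover have "{x \<in> V. l x = r} = {b}"
      proof
        show "{x \<in> V. l x = r} \<subseteq> {b}" using True by (auto intro!: fib)
      qed (use V True in simp)
      ultimately have "exceptional b" unfolding exceptional_def using V True by simp
      then show False using contra by blast
    qed
  qed
  then have "insert b X1 \<subset> V" using X1 V by blast
  then have less1: "card (insert b X1) < card V" using fin by (simp add: psubset_card_mono)
  have finX: "finite X" if "X \<subseteq> V" for X using that fin finite_subset by blast
  have "\<exists>p\<in>l ` insert b X1. p \<noteq> l b \<and> card (nbr_labels l E1 p) \<le> 2"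
    using less1 con1 X1 V ab by (intro smaller two_labelsI[of _ a b]) (auto intro: finX)
  then obtain x where x: "x \<in> X1" "card (nbr_labels l E1 (l x)) \<le> 2" by auto
  have same_A: "y \<in> A" if y: "y \<in> V" "l y = l x" "x \<in> A" "l x \<noteq> l c" for x y
  proof (cases "y = x")
    case False
    have "x \<in> V" using y(3) A(1) by blast
    then have "(x, y) \<in> E" using mate[of x y] y(1,2) False by simp
    then show ?thesis using leave[OF _ y(3), of y] y(2,4) ab(2) by auto
  qed (use y in simp)
  \<comment> \<open>The other labels in \<open>A\<close> keep all their edges in \<open>E1\<close>,
    so a low one would already be low in \<open>E\<close>.\<close>
  have "l x = l c"
  proof (rule ccontr)
    assume ne: "l x \<noteq> l c"
    then have xA: "x \<in> A" using x unfolding X1_def by blast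
    have "nbr_labels l E (l x) \<subseteq> nbr_labels l E1 (l x)"
    proof
      fix q assume "q \<in> nbr_labels l E (l x)"
      then obtain y z where yz: "(y, z) \<in> E" "l y = l x" "l z = q" "q \<noteq> l x" by (elim nbr_labelsE)
      have "y \<in> A"
        using same_A[OF _ yz(2) xA ne] wf[OF yz(1)] by blast
      then have "(y, z) \<in> E1"
        using leave[OF yz(1)] yz unfolding E1_def X1_def by blast
      then show "q \<in> nbr_labels l E1 (l x)" using nbr_labelsI[of y z E1 l "l x"] yz by simp
    qed
    then show False
      using not_low[of x] x xA r A contraction.finite_nbr_labels[OF con1] by blast
  qed
  then have low_c: "card (nbr_labels l E1 (l c)) \<le> 2" using x by simp
  define X2 where "X2 = {x \<in> A. l x \<noteq> l c}"
  have X2: "X2 \<subseteq> V" "X2 \<subseteq> A" "a \<in> X2" "b \<notin> X2" using A la unfolding X2_def by auto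
  have leave2: "y \<in> X2 \<or> l y = l c \<or> x = a \<and> y = b" if "(x, y) \<in> E" "x \<in> X2" for x y
    using leave[OF that(1)] that unfolding X2_def by blast
  obtain s t where st: "(s, t) \<in> E" "s \<in> X2" "l t = l c"
  proof (rule ccontr)
    assume "\<not> thesis"
    then have "\<And>x y. (x, y) \<in> E \<Longrightarrow> x \<in> X2 \<Longrightarrow> l y \<noteq> l c" using that by blast
    then have none: "l y \<noteq> l c" if "(x, y) \<in> E" "x \<in> X2" for x y using that by blast
    show False
    proof (rule no_bridge[OF X2(1,3,4)])
      show "y \<in> X2 \<or> x = a \<and> y = b" if "(x, y) \<in> E" "x \<in> X2" for x y
        using leave2[OF that] none[OF that] by blast
      show "l x \<noteq> r" if "x \<in> X2" for x using r that X2 by blast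
    qed
  qed
  have tX1: "t \<in> X1"
    using leave[OF st(1)] st lcb unfolding X1_def X2_def by auto
  \<comment> \<open>In \<open>E1\<close> the label of \<open>c\<close> is low and has
    \<open>l b\<close> as a neighbour, which leaves room for one label from
    \<open>X2\<close>.\<close>
  have only_s: "l x = l s" if xy: "(x, y) \<in> E" "x \<in> X2" "l y = l c" for x y
  proof (rule ccontr)
    assume ne: "l x \<noteq> l s"
    have in1: "l x' \<in> nbr_labels l E1 (l c)" if "(x', y') \<in> E" "x' \<in> X2" "l y' = l c" for x' y'
    proof (rule nbr_labelsI)
      have "y' \<in> X1" using leave[OF that(1)] that lcb unfolding X1_def X2_def by auto
      then show "(y', x') \<in> E1" using that sym unfolding E1_def X1_def X2_def by blast
    qed (use that in \<open>auto simp: X2_def\<close>)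
    have "l b \<in> nbr_labels l E1 (l c)"
      using lcb by (intro nbr_labelsI[of c b]) (auto simp: E1_def)
    then have "{l b, l x, l s} \<subseteq> nbr_labels l E1 (l c)" using in1 xy st by blast
    then have "card {l b, l x, l s} \<le> card (nbr_labels l E1 (l c))"
      using contraction.finite_nbr_labels[OF con1] by (intro card_mono) auto
    moreover have "l x \<noteq> l b" "l s \<noteq> l b" using lb X2(2) xy(2) st(2) by blast+
    then have "card {l b, l x, l s} = 3" using ne by auto
    ultimately show False using low_c by simp
  qed
  show False
  proof (cases "l s = l a")
    case True
    \<comment> \<open>The label of \<open>a\<close> is now the only exit from the rest of
      \<open>X2\<close>, so \<open>cut\<close> makes this rest empty. What remains is a label with
      at most the neighbours \<open>l b\<close> and \<open>l c\<close>.\<close>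
    have "{x \<in> X2. l x \<noteq> l a} = {}"
    proof (rule ccontr)
      assume ne: "{x \<in> X2. l x \<noteq> l a} \<noteq> {}"
      have "b \<in> {x \<in> X2. l x \<noteq> l a}"
      proof (rule cut[OF _ ne])
        show "y \<in> {x \<in> X2. l x \<noteq> l a} \<or> l y = l a"
          if "(x, y) \<in> E" "x \<in> {x \<in> X2. l x \<noteq> l a}" for x y
          using leave2[OF that(1)] only_s[OF that(1)] that True by auto
      qed (use X2 V r ab in auto)
      then show False using X2 by blast
    qed
    then have X2a: "l x = l a" if "x \<in> X2" for x using that by blast
    have "nbr_labels l E (l a) \<subseteq> {l b, l c}"
    proof
      fix q assume "q \<in> nbr_labels l E (l a)"
      then obtain y z where yz: "(y, z) \<in> E" "l y = l a" "l z = q" "q \<noteq> l a" by (elim nbr_labelsE)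
      have "y \<in> A"
        using same_A[OF _ yz(2) A(2)] wf[OF yz(1)] la by auto
      then have "y \<in> X2" using yz la unfolding X2_def by auto
      then show "q \<in> {l b, l c}" using leave2[OF yz(1)] X2a yz by auto
    qed
    then show False using not_low_pair[OF V(1)] r A by blast
  next
    case False
    \<comment> \<open>All edges into the label of \<open>c\<close> come from the label of \<open>s\<close>, so \<open>b\<close> can take the place of
      the whole label of \<open>c\<close> without lowering any degree in \<open>X2\<close>.\<close>
    define E2 where "E2 = E \<inter> X2 \<times> X2 \<union> {(a, b), (b, a), (b, s), (s, b)}"
    have "(b, c) \<in> (E \<inter> insert s (V - X2) \<times> insert s (V - X2))\<^sup>*" (is "_ \<in> ?R2\<^sup>*")
      using bc X2(2) by (elim set_rev_mp[OF _ rtrancl_mono]) blast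
    \<comment> \<open>The connection runs from \<open>b\<close> to \<open>c\<close> outside
      \<open>A\<close>, then to the partner \<open>t\<close> of \<open>c\<close> if \<open>t\<close>
      differs from \<open>c\<close>, and from there to \<open>s\<close>.\<close>
    moreover have "(c, t) \<in> ?R2\<^sup>*"
    proof (cases "t = c")
      case False
      then have "(c, t) \<in> ?R2" using mate[of c t] st cV wf A X2 unfolding X2_def by auto
      then show ?thesis by blast
    qed simp
    moreover have "(t, s) \<in> ?R2" using st sym wf unfolding X2_def by auto
    ultimately have bs: "(b, s) \<in> ?R2\<^sup>*" by (meson rtrancl_into_rtrancl rtrancl_trans)
    have con2: "contraction l (insert b X2) E2"
      unfolding E2_def
      by (rule contraction_augment[OF X2(1,3) st(2) _ V(2) X2(4) _ ab(1) bs])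
        (use False lbA X2(2) in auto)
    have "insert b X2 \<subseteq> insert b X1" using X2 unfolding X1_def by blast
    then have "card (insert b X2) \<le> card (insert b X1)"
      using X1 by (intro card_mono) (auto intro: finX)
    then have "\<exists>p\<in>l ` insert b X2. p \<noteq> l b \<and> card (nbr_labels l E2 p) \<le> 2"
      using less1 con2 X2 V ab by (intro smaller two_labelsI[of _ a b]) (auto intro: finX)
    then obtain x where x: "x \<in> X2" "card (nbr_labels l E2 (l x)) \<le> 2" by auto
    have xV: "x \<in> V" "x \<in> A" "l x \<noteq> l c" "l x \<noteq> r" using x X2 r unfolding X2_def by auto
    have nbrs: "q \<in> nbr_labels l E2 (l x) \<and> (l x \<noteq> l a \<longrightarrow> q \<noteq> l b) \<or> q = l c \<and> l x = l s"
      if "q \<in> nbr_labels l E (l x)" for q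
    proof -
      obtain y z where yz: "(y, z) \<in> E" "l y = l x" "l z = q" "q \<noteq> l x"
        using \<open>q \<in> nbr_labels l E (l x)\<close> by (elim nbr_labelsE)
      have "y \<in> A"
        using same_A[OF _ yz(2) xV(2,3)] wf[OF yz(1)] by blast
      then have y: "y \<in> X2" using yz xV unfolding X2_def by auto
      show ?thesis
      proof (cases "l z = l c")
        case True
        then show ?thesis using only_s[OF yz(1) y] yz by auto
      next
        case False
        then have z: "z \<in> X2 \<or> y = a \<and> z = b" using leave2[OF yz(1) y] by blast
        then have "(y, z) \<in> E2" using yz y unfolding E2_def by blast
        then have "q \<in> nbr_labels l E2 (l x)" using nbr_labelsI[of y z E2 l "l x"] yz by simp
        then show ?thesis using z yz lb X2 by auto
      qed
    qed
    have fin2: "finite (nbr_labels l E2 (l x))" using contraction.finite_nbr_labels[OF con2] .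
    show False
    proof (cases "l x = l s")
      case True
      \<comment> \<open>Passing from \<open>E\<close> to \<open>E2\<close>, the label of
        \<open>s\<close> exchanges its neighbour \<open>l c\<close> for \<open>l b\<close>, which
        was no neighbour before since \<open>l s\<close> differs from \<open>l a\<close>. So the
        count does not drop.\<close>
      have "l b \<in> nbr_labels l E2 (l x)"
        using True lb[of s] st X2 by (intro nbr_labelsI[of s b]) (auto simp: E2_def)
      then have "card (nbr_labels l E2 (l x) - {l b}) \<le> 1" using x fin2 by simp
      then have "card (insert (l c) (nbr_labels l E2 (l x) - {l b})) \<le> 2"
        using fin2 by (simp add: card_insert_if)
      moreover have "nbr_labels l E (l x) \<subseteq> insert (l c) (nbr_labels l E2 (l x) - {l b})"
        using nbrs True False by auto
      ultimately show False using not_low[OF xV(1,4)] fin2 by blast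
    next
      case False
      then have "nbr_labels l E (l x) \<subseteq> nbr_labels l E2 (l x)" using nbrs by blast
      then show False using not_low[OF xV(1,4)] fin2 x by blast
    qed
  qed
qed

text \<open>The two sides of a separation cannot both meet the root, since two vertices with the
  root label are adjacent. The root-free side is fed to \<open>exceptional_or_thin\<close>; an
  exceptional \<open>a\<close> is excluded because its label is not \<open>r\<close>.\<close>

lemma thin_cases:
  assumes ab: "(a, b) \<in> E" "l a \<noteq> l b" "l a \<noteq> r"
  shows "thin a b \<or> thin b a \<or> exceptional b"
proof -
  obtain A' c where A': "a \<in> A'" "b \<notin> A'" "c \<notin> A'" "c \<noteq> b"
    and leave': "\<And>x y. (x, y) \<in> E \<Longrightarrow> x \<in> A' \<Longrightarrow> y \<in> A' \<or> y = c \<or> x = a \<and> y = b"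
    using sep[OF ab(1,2)] unfolding separable_def by blast
  define A B where "A = A' \<inter> V" and "B = V - A' - {c}"
  have V: "a \<in> V" "b \<in> V" using ab wf by auto
  have leaveA: "y \<in> A \<or> y = c \<or> x = a \<and> y = b" if "(x, y) \<in> E" "x \<in> A" for x y
    using leave'[OF that(1)] that wf unfolding A_def by blast
  have leaveB: "y \<in> B \<or> y = c \<or> x = b \<and> y = a" if "(x, y) \<in> E" "x \<in> B" for x y
    using leave'[OF sym[OF that(1)]] that wf unfolding B_def by blast
  have "(\<forall>x\<in>A. l x \<noteq> r) \<or> (\<forall>x\<in>B. l x \<noteq> r)"
  proof (rule ccontr)
    assume "\<not> ?thesis"
    then obtain x y where xy: "x \<in> A" "y \<in> B" "l x = r" "l y = r" by blast
    then have "(x, y) \<in> E" using mate[of x y] unfolding A_def B_def by auto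
    then show False using leaveA xy ab unfolding A_def B_def by blast
  qed
  then show ?thesis
  proof
    assume "\<forall>x\<in>A. l x \<noteq> r"
    then show ?thesis
      using exceptional_or_thin[of a b A c] ab A' V leaveA unfolding A_def by blast
  next
    assume "\<forall>x\<in>B. l x \<noteq> r"
    then have "thin b a \<or> exceptional a"
      using ab A' V sym leaveB unfolding B_def
      by (intro exceptional_or_thin[of b a "V - A' - {c}" c]) auto
    then show ?thesis using ab unfolding exceptional_def by blast
  qed
qed

section \<open>Counting adjacent pairs of labels\<close>

lemma thin_unique:
  assumes "thin a b" "thin a' b'" "l a = l a'"
  shows "a = a' \<and> b = b'"
proof (cases "a = a'")
  case True
  then show ?thesis using assms unfolding thin_def by auto
next
  case False
  have V: "a \<in> V" "a' \<in> V" using assms wf unfolding thin_def by blast+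
  \<comment> \<open>Two different thin ends exhaust their label, so it would be low.\<close>
  have "nbr_labels l E (l a) \<subseteq> {l b, l b'}"
  proof
    fix q assume "q \<in> nbr_labels l E (l a)"
    then obtain y z where yz: "(y, z) \<in> E" "l y = l a" "l z = q" "q \<noteq> l a" by (elim nbr_labelsE)
    have "y = a \<or> y = a'" using pair[of y a a'] yz wf V assms(3) False by auto
    then show "q \<in> {l b, l b'}" using yz assms unfolding thin_def by auto
  qed
  then have False using not_low_pair[OF V(1)] assms unfolding thin_def by blast
  then show ?thesis ..
qed

lemma card_exceptional: "card {(a, b). exceptional b \<and> a \<in> outer b} \<le> 2"
proof -
  let ?R = "{x \<in> V. l x = r}"
  let ?X = "{b. exceptional b}"
  have finX: "finite ?R" "finite ?X" and sub: "?X \<subseteq> ?R"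
    using fin finite_subset[of ?X V] unfolding exceptional_def by auto
  have fo: "finite (outer b)" for b
    using finite_subset[of "outer b" V] fin wf unfolding outer_def by blast
  have "{(a, b). exceptional b \<and> a \<in> outer b} = prod.swap ` (SIGMA b:?X. outer b)" by auto
  then have "card {(a, b). exceptional b \<and> a \<in> outer b} = card (SIGMA b:?X. outer b)"
    by (simp add: card_image)
  also have "\<dots> = (\<Sum>b\<in>?X. card (outer b))" using finX fo by (simp add: card_SigmaI)
  also have "\<dots> \<le> 2"
  proof (cases "\<exists>b. ?R = {b}")
    case True
    then obtain b where "?R = {b}" by blast
    then have "?X \<subseteq> {b}" using sub by simp
    then have "?X = {} \<or> ?X = {b}" by (rule subset_singletonD)
    then show ?thesis
    proof
      assume X: "?X = {b}"
      then have "card (outer b) \<le> 2" unfolding exceptional_def by auto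
      then show ?thesis unfolding X by simp
    qed (simp only: sum.empty)
  next
    case False
    then have "(\<Sum>b\<in>?X. card (outer b)) \<le> (\<Sum>b\<in>?X. 1)"
      by (intro sum_mono) (auto simp: exceptional_def)
    also have "\<dots> = card ?X" by simp
    also have "\<dots> \<le> card ?R" using finX sub by (intro card_mono)
    also have "card ?R \<le> 2"
    proof (rule ccontr)
      assume "\<not> card ?R \<le> 2"
      then have "3 \<le> card ?R" by simp
      then obtain T where "T \<subseteq> ?R" "card T = 3"
        by (rule obtain_subset_with_card_n)
      then obtain x y z where "T = {x, y, z}" "x \<noteq> y" "y \<noteq> z" "x \<noteq> z"
        by (auto simp: card_3_iff)
      then have "x \<in> ?R" "y \<in> ?R" "z \<in> ?R" using \<open>T \<subseteq> ?R\<close> by auto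
      then show False using pair[of x y z] \<open>x \<noteq> y\<close> \<open>y \<noteq> z\<close> \<open>x \<noteq> z\<close> by auto
    qed
    finally show ?thesis .
  qed
  finally show ?thesis .
qed

lemma contradiction: False
proof -
  define N where "N = l ` V - {r}"
  define T where "T = {(a, b). thin a b}"
  define P where "P = (SIGMA p:N. nbr_labels l E p)"
  let ?l = "map_prod l l"
  let ?X = "{(a, b). exceptional b \<and> a \<in> outer b}"
  have finN: "finite N" unfolding N_def using fin by simp
  have finT: "finite T" and finX: "finite ?X"
    using fin finite_subset[of T "V \<times> V"] finite_subset[of ?X "V \<times> V"] wf
    unfolding T_def thin_def outer_def exceptional_def by auto
  have "card T \<le> card N"
  proof (rule card_inj_on_le[of "l \<circ> fst"])
    show "inj_on (l \<circ> fst) T" using thin_unique unfolding T_def inj_on_def by auto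
    show "(l \<circ> fst) ` T \<subseteq> N" using wf unfolding T_def thin_def N_def by auto
  qed (rule finN)
  have "P \<subseteq> ?l ` T \<union> prod.swap ` ?l ` T \<union> ?l ` ?X"
  proof
    fix pq assume "pq \<in> P"
    then obtain a b where ab: "pq = (l a, l b)" "(a, b) \<in> E" "l a \<noteq> l b" "l a \<noteq> r"
      unfolding P_def N_def by (fastforce elim!: nbr_labelsE)
    from thin_cases[OF ab(2-)] consider "thin a b" | "thin b a" | "exceptional b" by blast
    \<comment> \<open>A thin edge accounts for two ordered pairs of labels, hence the factor 2 in
      the upper bound.\<close>
    then show "pq \<in> ?l ` T \<union> prod.swap ` ?l ` T \<union> ?l ` ?X"
    proof cases
      case 3
      then have "(a, b) \<in> ?X" using ab sym unfolding outer_def by blast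
      then show ?thesis using ab by force
    qed (force simp: ab T_def)+
  qed
  then have "card P \<le> card (?l ` T \<union> prod.swap ` ?l ` T \<union> ?l ` ?X)"
    using finT finX by (intro card_mono) auto
  also have "\<dots> \<le> card (?l ` T) + card (prod.swap ` ?l ` T) + card (?l ` ?X)"
    by (meson add_mono card_Un_le le_refl le_trans)
  also have "\<dots> \<le> card N + card N + 2"
    using \<open>card T \<le> card N\<close> card_exceptional finT finX
    by (intro add_mono) (meson card_image_le finite_imageI le_trans)+
  finally have upper: "card P \<le> 2 * card N + 2" by simp
  have "card P = (\<Sum>p\<in>N. card (nbr_labels l E p))"
    unfolding P_def using finN finite_nbr_labels by (simp add: card_SigmaI)
  also have "\<dots> \<ge> (\<Sum>p\<in>N. 3)" using high unfolding N_def by (intro sum_mono) auto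
  finally have lower: "3 * card N \<le> card P" by simp
  have "N \<noteq> {}"
  proof
    assume "N = {}"
    then have "l ` V \<subseteq> {r}" unfolding N_def by blast
    then have "card (l ` V) \<le> card {r}" by (intro card_mono) auto
    then show False using two_labels by simp
  qed
  then obtain p where p: "p \<in> N" by blast
  \<comment> \<open>Three neighbours among \<open>r\<close> and the rest of \<open>N\<close> force
    \<open>card N\<close> to be at least 3, while the two bounds allow at most 2.\<close>
  have "nbr_labels l E p \<subseteq> insert r (N - {p})"
    using wf unfolding N_def by (auto elim!: nbr_labelsE)
  then have "card (nbr_labels l E p) \<le> card (insert r (N - {p}))"
    using finN by (intro card_mono) auto
  also have "\<dots> = Suc (card (N - {p}))" using finN by (intro card_insert_disjoint) (auto simp: N_def)
  also have "\<dots> = card N" by (rule card_Suc_Diff1[OF finN p])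
  finally have "3 \<le> card N" using high[of p] p unfolding N_def by simp
  then show False using upper lower by simp
qed

end

text \<open>The induction is on vertices, not labels: a reduction that drops only one vertex of a
  pair keeps every label.\<close>

theorem contraction_low_label:
  assumes "contraction l V E" "r \<in> l ` V" "2 \<le> card (l ` V)"
  shows "\<exists>p\<in>l ` V. p \<noteq> r \<and> card (nbr_labels l E p) \<le> 2"
  using assms
proof (induction "card V" arbitrary: V E r rule: less_induct)
  case less
  show ?case
  proof (rule ccontr)
    assume "\<not> ?case"
    then have "rooted_counterexample l V E r"
      using less by (intro rooted_counterexample.intro rooted_counterexample_axioms.intro)
        (auto simp: not_le Suc_le_eq numeral_3_eq_3 numeral_2_eq_2)
    then show False by (rule rooted_counterexample.contradiction)
  qed
qed

section \<open>Property P and subgraphs of the contracted graph\<close>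

lemma set_zip_walk: "walk R (x # xs @ [y]) \<Longrightarrow> set (zip (x # xs) (xs @ [y])) \<subseteq> R"
  by (induction xs arbitrary: x) (auto simp: successively_Cons)

lemma pcas_zip: "pcas x (zip (x # xs) (xs @ [y])) y"
  by (induction xs arbitrary: x) auto

lemma pawalk_verts_zip: "pawalk_verts x (zip (x # xs) (xs @ [y])) = x # xs @ [y]"
  by (induction xs arbitrary: x) auto

lemma cycle_throughI:
  assumes C: "cyc (parcs G) C" "3 \<le> length C" "a \<in> set C" "b \<in> set C" and "set C \<subseteq> pverts G"
  shows "cycle_through G a b"
proof -
  obtain x xs where x: "C = x # xs" using C(1) unfolding cyc_def by (cases C) auto
  \<comment> \<open>Zipping the vertex list with its rotation by one gives the arcs of the closed
    walk.\<close>
  let ?p = "zip (x # xs) (xs @ [x])"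
  have "walk (parcs G) (x # xs @ [x])" "distinct (xs @ [x])"
    using C(1) unfolding x cyc_def by (auto simp: successively_Cons successively_append_iff hd_append)
  then have "pre_digraph.cycle (with_proj G) ?p"
    using assms(5) set_zip_walk[of "parcs G" x xs x] pcas_zip[of x xs x]
    unfolding pre_digraph.cycle_def pre_digraph.awalk_def cas_with_proj_eq awalk_verts_with_proj_eq x
    by (intro exI[of _ x]) (auto simp: pawalk_verts_zip simp del: zip_Cons_Cons)
  moreover have "3 \<le> length ?p" using C(2) x by simp
  moreover have "fst ` set ?p = set C"
    unfolding x set_map[symmetric] by (subst map_fst_zip) auto
  ultimately show ?thesis unfolding cycle_through_def using C(3,4) by (intro exI[of _ ?p]) auto
qed

text \<open>The side \<open>A\<close> consists of the vertices reachable from \<open>a\<close>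
  without the edge \<open>ab\<close> and without the vertex \<open>c\<close> given by
  \<open>cyc_or_cut\<close>.\<close>

lemma separableI_no_cycle:
  assumes G: "pair_graph G" and ab: "a \<in> pverts G" "a \<noteq> b" "d \<noteq> a" "d \<noteq> b"
    and no_cycle: "\<not> cycle_through (del_edge G a b) a b"
  shows "separable (parcs G) a b"
proof -
  interpret pair_graph G by (rule G)
  let ?R = "parcs (del_edge G a b)"
  have sym_G: "Relation.sym (parcs G)"
    using sym_arcs unfolding symmetric_def by simp
  have sym_R: "Relation.sym ?R"
    using sym_G unfolding del_edge_def by (auto simp: Relation.sym_def)
  have "False" if C: "cyc ?R C" "3 \<le> length C" "a \<in> set C" "b \<in> set C" for C
  proof -
    have "set C \<subseteq> pverts G"
    proof
      fix x assume "x \<in> set C"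
      then obtain us vs where "C = us @ x # vs" by (meson split_list)
      then have "cyc ?R (x # vs @ us)" using cyc_rotate[of ?R us "x # vs"] C(1) by simp
      then have "(last (x # vs @ us), x) \<in> ?R" unfolding cyc_def by simp
      then show "x \<in> pverts G" using in_arcsD2 unfolding del_edge_def by auto
    qed
    then show False using cycle_throughI[OF C] no_cycle unfolding del_edge_def by simp
  qed
  then obtain c where c: "c \<noteq> a" "c \<noteq> b" "(a, b) \<notin> (avoiding ?R c)\<^sup>*"
    using cyc_or_cut[OF sym_R _ ab(2-4)] unfolding del_edge_def by auto
  show ?thesis
  proof (rule separableI[of a "(avoiding ?R c)\<^sup>* `` {a}" b c])
    show "c \<notin> (avoiding ?R c)\<^sup>* `` {a}"
      using c(1) by (auto simp: avoiding_def elim: rtranclE)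
    show "y \<in> (avoiding ?R c)\<^sup>* `` {a} \<or> y = c \<or> x = a \<and> y = b"
      if xy: "(x, y) \<in> parcs G" "x \<in> (avoiding ?R c)\<^sup>* `` {a}" for x y
    proof (cases "y = c \<or> x = a \<and> y = b")
      case False
      have "x \<noteq> b" "x \<noteq> c" using xy(2) c by (auto simp: avoiding_def elim: rtranclE)
      then have "(x, y) \<in> avoiding ?R c"
        using xy(1) False unfolding avoiding_def del_edge_def by auto
      then show ?thesis using xy(2) by (auto intro: rtrancl_into_rtrancl)
    qed blast
  qed (use c in auto)
qed

theorem theorem3:
  fixes G :: "'a pair_pre_digraph" and M :: "'a set set"
    and H :: "'a set pair_pre_digraph"
  assumes "pair_graph G"
    and "matching G M"
    and "property_P G M"
    and "pair_graph H"
    and "subgraph (with_proj H) (with_proj (contract_matching G M))"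
    and "2 \<le> card (pverts H)"
  shows "\<exists>u v. u \<in> pverts H \<and> v \<in> pverts H \<and> u \<noteq> v \<and>
           out_degree (with_proj H) u \<le> 2 \<and> out_degree (with_proj H) v \<le> 2"
proof -
  interpret G: pair_graph G by (rule assms(1))
  interpret H: pair_graph H by (rule assms(4))
  \<comment> \<open>For a vertex covered by \<open>M\<close> the union has a single member, its
    matching edge.\<close>
  define l where "l x = \<Union>{e \<in> M. x \<in> e}" for x
  define V where "V = \<Union>(pverts H)"
  \<comment> \<open>\<open>H\<close> need not be induced, so only edges of \<open>G\<close> lying
    over an edge of \<open>H\<close> or inside a matching edge are kept.\<close>
  define E where "E = {(x, y) \<in> parcs G. x \<in> V \<and> y \<in> V \<and> (l x = l y \<or> (l x, l y) \<in> parcs H)}"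
  have sub: "pverts H \<subseteq> M" "parcs H \<subseteq> parcs (contract_matching G M)"
    using assms(5) by (auto simp: subgraph_def contract_matching_def)
  have edge: "\<exists>x y. e = {x, y} \<and> (x, y) \<in> parcs G" if "e \<in> M" for e
    using assms(2) that unfolding matching_def by blast
  have sym_G: "(y, x) \<in> parcs G" if "(x, y) \<in> parcs G" for x y
    using G.graph_symmetric that by simp
  have l: "l x = e" if "e \<in> M" "x \<in> e" for x e
  proof -
    have "{e \<in> M. x \<in> e} = {e}" using assms(2) that unfolding matching_def by blast
    then show ?thesis unfolding l_def by simp
  qed
  have V: "l x \<in> pverts H" "l x \<in> M" "x \<in> l x" if "x \<in> V" for x
    using that l sub unfolding V_def by blast+
  have lV: "l ` V = pverts H"
  proof
    show "pverts H \<subseteq> l ` V"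
    proof
      fix e assume e: "e \<in> pverts H"
      then obtain x where "x \<in> e" using edge sub by blast
      then show "e \<in> l ` V" using l e sub unfolding V_def by blast
    qed
  qed (use V in blast)
  have VG: "V \<subseteq> pverts G"
  proof
    fix x assume x: "x \<in> V"
    obtain u v where "l x = {u, v}" "(u, v) \<in> parcs G" using edge V(2)[OF x] by blast
    then show "x \<in> pverts G" using V(3)[OF x] G.in_arcsD1[of u v] G.in_arcsD2[of u v] by auto
  qed
  interpret contraction l V E
  proof
    show "finite V" using VG G.pair_finite_verts finite_subset by blast
    show "x \<in> V \<and> y \<in> V" if "(x, y) \<in> E" for x y using that unfolding E_def by blast
    show "(y, x) \<in> E" if "(x, y) \<in> E" for x y
      using that sym_G H.graph_symmetric unfolding E_def by auto
    show "(x, y) \<in> E" if xy: "x \<in> V" "y \<in> V" "x \<noteq> y" "l x = l y" for x y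
    proof -
      obtain u v where "l x = {u, v}" "(u, v) \<in> parcs G" using edge V(2) xy(1) by blast
      then have "(x, y) \<in> parcs G" using V(3)[OF xy(1)] V(3)[OF xy(2)] xy(3,4) sym_G by auto
      then show ?thesis using xy unfolding E_def by simp
    qed
    show "x = y \<or> y = z \<or> x = z"
      if xyz: "x \<in> V" "y \<in> V" "z \<in> V" "l x = l y" "l y = l z" for x y z
    proof -
      obtain u v where "l x = {u, v}" using edge V(2) xyz(1) by blast
      then show ?thesis using V(3)[OF xyz(1)] V(3)[OF xyz(2)] V(3)[OF xyz(3)] xyz(4,5) by auto
    qed
    show "separable E a b" if ab: "(a, b) \<in> E" "l a \<noteq> l b" for a b
    proof -
      have abG: "(a, b) \<in> parcs G" "a \<in> V" "b \<in> V" using ab(1) unfolding E_def by auto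
      have "{a, b} \<notin> M" using ab(2) l by blast
      moreover have "a \<in> \<Union>M" "b \<in> \<Union>M" using V abG by blast+
      ultimately have no_cycle: "\<not> cycle_through (del_edge G a b) a b"
        using assms(3) abG(1) unfolding property_P_def matching_subgraph_def by auto
      obtain u v where uv: "l a = {u, v}" "(u, v) \<in> parcs G" using edge V(2) abG(2) by blast
      have "u \<noteq> v" using G.pair_no_loops[OF uv(2)] by simp
      \<comment> \<open>The partner of \<open>a\<close> is the third vertex required for
        \<open>separableI_no_cycle\<close>.\<close>
      then obtain d where d: "d \<noteq> a" "d \<in> l a" unfolding uv(1) by (cases "u = a") auto
      have "d \<noteq> b" using d(2) ab(2) l[OF V(2)[OF abG(2)]] by auto
      then have "separable (parcs G) a b"
        using abG(2) VG ab(2) d(1) by (intro separableI_no_cycle[OF assms(1) _ _ _ _ no_cycle]) auto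
      then show ?thesis unfolding separable_def E_def by blast
    qed
  qed
  have degree: "out_degree (with_proj H) p \<le> card (nbr_labels l E p)" if "p \<in> pverts H" for p
  proof -
    have "out_arcs (with_proj H) p \<subseteq> Pair p ` nbr_labels l E p"
    proof
      fix e assume "e \<in> out_arcs (with_proj H) p"
      then obtain q where e: "e = (p, q)" "(p, q) \<in> parcs H"
        unfolding out_arcs_def by (cases e) auto
      then have "(p, q) \<in> parcs (contract_matching G M)" using sub(2) by blast
      then obtain x y where xy: "x \<in> p" "y \<in> q" "(x, y) \<in> parcs G" "p \<noteq> q" "p \<in> M" "q \<in> M"
        unfolding contract_matching_def matching_subgraph_def by (auto simp: arcs_ends_conv)
      have "x \<in> V" "y \<in> V" using xy(1,2) e(2) H.in_arcsD1 H.in_arcsD2 unfolding V_def by blast+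
      then have "(x, y) \<in> E" using xy e l unfolding E_def by auto
      then have "q \<in> nbr_labels l E p" using nbr_labelsI[of x y E l p] xy l by auto
      then show "e \<in> Pair p ` nbr_labels l E p" using e by blast
    qed
    then have "card (out_arcs (with_proj H) p) \<le> card (Pair p ` nbr_labels l E p)"
      using finite_nbr_labels by (intro card_mono) auto
    also have "\<dots> \<le> card (nbr_labels l E p)" using finite_nbr_labels by (rule card_image_le)
    finally show ?thesis unfolding out_degree_def .
  qed
  have low: "\<exists>p\<in>pverts H. p \<noteq> r \<and> out_degree (with_proj H) p \<le> 2" if "r \<in> pverts H" for r
    using contraction_low_label[OF contraction_axioms, of r] that assms(6) degree
    unfolding lV by (meson le_trans)
  obtain r where "r \<in> pverts H" using assms(6) by fastforce
  then obtain u where u: "u \<in> pverts H" "out_degree (with_proj H) u \<le> 2" using low by blast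
  \<comment> \<open>The first low vertex \<open>u\<close> becomes the root, which makes the second
    one different from it.\<close>
  then obtain v where "v \<in> pverts H" "v \<noteq> u" "out_degree (with_proj H) v \<le> 2" using low by blast
  then show ?thesis using u by blast
qed

end
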